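(* Let $(\mathcal X,A,B,K)$ satisfy the standing assumptions below. Then for every $\psi_0\in\mathcal X$ the attainable set from $\psi_0$ of the system $\psi'=A\psi+u(t)B\psi+K(\psi)$, namely $$\bigcup_{t\ge 0}\ \bigcup_{u\in L^1([0,t])}\{\Phi^u(t)\psi_0\},$$ is contained in a countable union of compact subsets of $\mathcal X$.
   Context: Standing assumptions: $\mathcal X$ is a real Banach space with norm $\|\cdot\|_{\mathcal X}$; $A:D(A)\subset\mathcal X\to\mathcal X$ is a linear operator generating a $C^0$ semigroup $(e^{tA})_{t\ge0}$ of bounded operators, with constants $\omega\ge0$, $M>0$ such that $\|e^{tA}\|_{L(\mathcal X)}\le Me^{\omega t}$ for all $t\ge0$; $B:\mathcal X\to\mathcal X$ is a bounded linear operator; $K:\mathcal X\to\mathcal X$ is (possibly nonlinear) $k$-Lipschitz with $k>0$. Controls $u$ are real-valued. A mild solution on $[0,T]$ with initial value $\psi_0$ is a continuous $\psi:[0,T]\to\mathcal X$ with $\psi(t)=e^{tA}\psi_0+\int_0^t u(s)e^{(t-s)A}B\psi(s)\,ds+\int_0^t e^{(t-s)A}K(\psi(s))\,ds$ for all $t\in[0,T]$. Such a solution exists and is unique for every $u\in L^1([0,T])$, $\psi_0\in\mathcal X$; $\Phi^u(t)\psi_0$ denotes its value at time $t$. *)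

theory Defs
  imports "HOL-Analysis.Analysis"
begin

definition c0_semigroup :: "(real \<Rightarrow> 'a::banach \<Rightarrow> 'a) \<Rightarrow> bool" where
  "c0_semigroup S \<longleftrightarrow>
     (\<forall>t\<ge>0. bounded_linear (S t)) \<and>
     S 0 = id \<and>
     (\<forall>t\<ge>0. \<forall>s\<ge>0. S (t + s) = S t \<circ> S s) \<and>
     (\<forall>x. ((\<lambda>t. S t x) \<longlongrightarrow> x) (at_right 0))"

definition generator ::
  "(real \<Rightarrow> 'a::banach \<Rightarrow> 'a) \<Rightarrow> ('a \<Rightarrow> 'a) \<Rightarrow> 'a set \<Rightarrow> bool" where
  "generator S A D \<longleftrightarrow>
     D = {x. \<exists>y. ((\<lambda>h. (1 / h) *\<^sub>R (S h x - x)) \<longlongrightarrow> y) (at_right 0)} \<and>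
     (\<forall>x\<in>D. ((\<lambda>h. (1 / h) *\<^sub>R (S h x - x)) \<longlongrightarrow> A x) (at_right 0))"

text \<open>Mild solution on [0,Tf] with control u and initial value psi0
  (integrals are Henstock-Kurzweil integrals, which agree with the Bochner
  integrals here).\<close>
definition mild_solution ::
  "(real \<Rightarrow> 'a::banach \<Rightarrow> 'a) \<Rightarrow> ('a \<Rightarrow> 'a) \<Rightarrow> ('a \<Rightarrow> 'a) \<Rightarrow> (real \<Rightarrow> real)
    \<Rightarrow> 'a \<Rightarrow> real \<Rightarrow> (real \<Rightarrow> 'a) \<Rightarrow> bool" where
  "mild_solution S B K u psi0 Tf psi \<longleftrightarrow>
     continuous_on {0..Tf} psi \<and>
     (\<forall>t\<in>{0..Tf}.
        (\<lambda>s. u s *\<^sub>R S (t - s) (B (psi s))) integrable_on {0..t} \<and>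
        (\<lambda>s. S (t - s) (K (psi s))) integrable_on {0..t} \<and>
        psi t = S t psi0
                + integral {0..t} (\<lambda>s. u s *\<^sub>R S (t - s) (B (psi s)))
                + integral {0..t} (\<lambda>s. S (t - s) (K (psi s))))"

definition attainable_set ::
  "(real \<Rightarrow> 'a::banach \<Rightarrow> 'a) \<Rightarrow> ('a \<Rightarrow> 'a) \<Rightarrow> ('a \<Rightarrow> 'a) \<Rightarrow> 'a \<Rightarrow> 'a set" where
  "attainable_set S B K psi0 =
     {psi t | t u psi. t \<ge> 0 \<and> u absolutely_integrable_on {0..t} \<and>
                        mild_solution S B K u psi0 t psi}"

end

theory Submission
  imports Defs
begin

text \<open>
  Fix \<open>N\<close> and consider the trajectories with \<open>T \<le> N\<close>, \<open>\<integral>|u| \<le> N\<close> and \<open>\<parallel>\<psi>\<parallel> \<le> N\<close>. If their values at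
  time \<open>s\<close> lie within \<open>\<epsilon> w\<^sub>u(s)\<close> of a finite set, where \<open>w\<^sub>u(s) = exp (\<mu> \<integral>\<^sub>0\<^sup>s (|u| + 1))\<close>, then the
  integrand of Duhamel's formula lies, up to an error \<open>(|u| + 1) O(\<epsilon>) w\<^sub>u\<close>, in \<open>(|u| + 1) C\<close> with \<open>C\<close> the
  convex hull of a finite set. Hence the integral is close to the compact set \<open>[0, 2N] C\<close>, and
  since \<open>\<integral>\<^sub>0\<^sup>t (|u| + 1) w\<^sub>u \<le> (2/\<mu>) w\<^sub>u(t)\<close>, choosing \<open>\<mu>\<close> large halves the error. Iterating, and using
  that \<open>w\<^sub>u \<le> exp (2 \<mu> N)\<close>, the values are totally bounded; finally let \<open>N\<close> run through the naturals.
\<close>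

section \<open>Finite nets, convex averages and integrals near a convex set\<close>

lemma compact_finite_net:
  fixes P :: "'a::real_normed_vector set"
  assumes "compact P" "\<delta> > 0"
  obtains F where "finite F" "\<And>x. x \<in> P \<Longrightarrow> \<exists>p\<in>F. norm (x - p) \<le> \<delta>"
proof -
  obtain F where F: "finite F" "P \<subseteq> (\<Union>x\<in>F. ball x \<delta>)"
    using assms unfolding compact_eq_totally_bounded by blast
  show ?thesis
  proof
    fix x assume "x \<in> P"
    then obtain p where "p \<in> F" "dist p x < \<delta>" using F(2) by auto
    then show "\<exists>p\<in>F. norm (x - p) \<le> \<delta>"
      by (intro bexI[of _ p]) (simp_all add: dist_norm norm_minus_commute)
  qed (rule F(1))
qed

text \<open>Dividing by the total weight gives a convex combination. If the total is 0, every weight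
  vanishes and any point of \<open>C\<close> serves, so Riemann sums with vanishing weights are
  covered too.\<close>

lemma convex_weighted_sum:
  fixes C :: "'a::real_vector set"
  assumes "convex C" "C \<noteq> {}" "finite I"
    and a: "\<And>i. i \<in> I \<Longrightarrow> 0 \<le> a i" and y: "\<And>i. i \<in> I \<Longrightarrow> y i \<in> C"
  shows "\<exists>c\<in>C. (\<Sum>i\<in>I. a i *\<^sub>R y i) = sum a I *\<^sub>R c"
proof (cases "sum a I = 0")
  case True
  then have "\<And>i. i \<in> I \<Longrightarrow> a i = 0"
    using assms sum_nonneg_eq_0_iff by metis
  with True \<open>C \<noteq> {}\<close> show ?thesis by auto
next
  case False
  have "(\<Sum>i\<in>I. (a i / sum a I) *\<^sub>R y i) \<in> C"
    using False assms by (intro convex_sum) (auto simp: sum_nonneg simp flip: sum_divide_distrib)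
  moreover have "(\<Sum>i\<in>I. a i *\<^sub>R y i) = sum a I *\<^sub>R (\<Sum>i\<in>I. (a i / sum a I) *\<^sub>R y i)"
    using False by (simp add: scaleR_sum_right)
  ultimately show ?thesis by blast
qed

text \<open>Comparing Riemann sums of \<open>h\<close>, \<open>v\<close> and \<open>e\<close> over a common fine division avoids any measurable
  selection of the points of \<open>C\<close>.\<close>

lemma integral_near_compact_convex:
  fixes h :: "'n::euclidean_space \<Rightarrow> 'a::banach" and v e :: "'n \<Rightarrow> real"
  assumes h: "h integrable_on cbox a b" and v: "v integrable_on cbox a b"
    and e: "e integrable_on cbox a b"
    and C: "convex C" "compact C" "C \<noteq> {}"
    and v0: "\<And>s. s \<in> cbox a b \<Longrightarrow> 0 \<le> v s"
    and near: "\<And>s. s \<in> cbox a b \<Longrightarrow> \<exists>c\<in>C. norm (h s - v s *\<^sub>R c) \<le> e s"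
  shows "\<exists>c\<in>C. norm (integral (cbox a b) h - integral (cbox a b) v *\<^sub>R c) \<le> integral (cbox a b) e"
proof -
  define H V E where "H = integral (cbox a b) h" and "V = integral (cbox a b) v"
    and "E = integral (cbox a b) e"
  \<comment> \<open>The minimiser \<open>c0\<close> is fixed before any division is chosen. The
    point found for each \<theta> is only compared with it, so no limit of these points is
    taken.\<close>
  have "continuous_on C (\<lambda>c. norm (H - V *\<^sub>R c))"
    by (intro continuous_intros)
  then obtain c0 where c0: "c0 \<in> C"
    "\<And>c. c \<in> C \<Longrightarrow> norm (H - V *\<^sub>R c0) \<le> norm (H - V *\<^sub>R c)"
    using continuous_attains_inf[OF C(2,3)] by metis
  obtain R where R: "R > 0" "\<And>c. c \<in> C \<Longrightarrow> norm c \<le> R"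
    using compact_imp_bounded[OF C(2)] bounded_pos by metis
  obtain g where g: "\<And>s. s \<in> cbox a b \<Longrightarrow> g s \<in> C"
    "\<And>s. s \<in> cbox a b \<Longrightarrow> norm (h s - v s *\<^sub>R g s) \<le> e s"
    using near by metis
  have "norm (H - V *\<^sub>R c0) \<le> E + \<theta>" if "\<theta> > 0" for \<theta>
  proof -
    \<comment> \<open>The three Riemann sums contribute \<open>\<eta>\<close> (for
      \<open>h\<close>), \<open>\<eta> * R\<close> (for \<open>v\<close>, multiplied by a point of
      \<open>C\<close>) and \<open>\<eta>\<close> (for \<open>e\<close>), in total
      \<open>\<theta>\<close>.\<close>
    define \<eta> where "\<eta> = \<theta> / (2 + R)"
    have \<eta>: "\<eta> > 0" using that R(1) by (simp add: \<eta>_def)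
    have "\<eta> * (2 + R) = \<theta>" using R(1) by (simp add: \<eta>_def)
    then have \<eta>_sum: "\<eta> + \<eta> * R + \<eta> = \<theta>" by (simp add: algebra_simps)
    obtain \<gamma>1 where 1: "gauge \<gamma>1" "\<And>\<D>. \<D> tagged_division_of (cbox a b) \<Longrightarrow> \<gamma>1 fine \<D> \<Longrightarrow>
        norm ((\<Sum>(x,k)\<in>\<D>. measure lborel k *\<^sub>R h x) - H) < \<eta>"
      using has_integralD[OF integrable_integral[OF h] \<eta>] unfolding H_def by metis
    obtain \<gamma>2 where 2: "gauge \<gamma>2" "\<And>\<D>. \<D> tagged_division_of (cbox a b) \<Longrightarrow> \<gamma>2 fine \<D> \<Longrightarrow>
        norm ((\<Sum>(x,k)\<in>\<D>. measure lborel k *\<^sub>R v x) - V) < \<eta>"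
      using has_integralD[OF integrable_integral[OF v] \<eta>] unfolding V_def by metis
    obtain \<gamma>3 where 3: "gauge \<gamma>3" "\<And>\<D>. \<D> tagged_division_of (cbox a b) \<Longrightarrow> \<gamma>3 fine \<D> \<Longrightarrow>
        norm ((\<Sum>(x,k)\<in>\<D>. measure lborel k *\<^sub>R e x) - E) < \<eta>"
      using has_integralD[OF integrable_integral[OF e] \<eta>] unfolding E_def by metis
    obtain p where p: "p tagged_division_of (cbox a b)" "(\<lambda>x. \<gamma>1 x \<inter> (\<gamma>2 x \<inter> \<gamma>3 x)) fine p"
      using fine_division_exists gauge_Int[OF 1(1) gauge_Int[OF 2(1) 3(1)]] by metis
    have fine: "\<gamma>1 fine p" "\<gamma>2 fine p" "\<gamma>3 fine p"
      using p(2) by (auto simp: fine_Int)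
    note fin = tagged_division_of_finite[OF p(1)]
    have tag: "x \<in> cbox a b" if "(x, k) \<in> p" for x k
      using p(1) that tagged_division_ofD(2,3) by blast
    define Sh where "Sh = (\<Sum>(x,k)\<in>p. measure lborel k *\<^sub>R h x)"
    define Sv where "Sv = (\<Sum>(x,k)\<in>p. measure lborel k * v x)"
    define Se where "Se = (\<Sum>(x,k)\<in>p. measure lborel k * e x)"
    \<comment> \<open>The weights are nonnegative with sum \<open>Sv\<close>, so the Riemann sum of
      \<open>v\<close> times \<open>g\<close> collapses to \<open>Sv\<close> times a single point of
      \<open>C\<close>.\<close>
    have "\<exists>c\<in>C. (\<Sum>q\<in>p. (measure lborel (snd q) * v (fst q)) *\<^sub>R g (fst q))
        = (\<Sum>q\<in>p. measure lborel (snd q) * v (fst q)) *\<^sub>R c"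
      using C(1,3) fin by (rule convex_weighted_sum) (auto dest!: tag simp: v0 g)
    then obtain c where c: "c \<in> C"
      "(\<Sum>(x,k)\<in>p. (measure lborel k * v x) *\<^sub>R g x) = Sv *\<^sub>R c"
      by (auto simp: Sv_def case_prod_beta)
    have "norm (Sh - Sv *\<^sub>R c) = norm (\<Sum>(x,k)\<in>p. measure lborel k *\<^sub>R (h x - v x *\<^sub>R g x))"
      unfolding c(2)[symmetric] Sh_def
      by (simp add: sum_subtractf[symmetric] case_prod_beta scaleR_diff_right)
    also have "\<dots> \<le> (\<Sum>(x,k)\<in>p. measure lborel k * e x)"
      by (rule sum_norm_le) (auto dest!: tag intro!: mult_left_mono g)
    finally have 4: "norm (Sh - Sv *\<^sub>R c) \<le> Se" by (simp add: Se_def)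
    have "norm (H - V *\<^sub>R c) = norm ((H - Sh) + (Sh - Sv *\<^sub>R c) + (Sv - V) *\<^sub>R c)"
      by (simp add: algebra_simps)
    also have "\<dots> \<le> norm (Sh - H) + norm (Sh - Sv *\<^sub>R c) + \<bar>Sv - V\<bar> * norm c"
      by (intro order_trans[OF norm_triangle_ineq] add_mono norm_triangle_ineq)
        (simp_all add: norm_minus_commute)
    also have "\<dots> \<le> \<eta> + Se + \<eta> * R"
    proof -
      have "norm (Sh - H) \<le> \<eta>" using 1(2)[OF p(1) fine(1)] by (simp add: Sh_def)
      moreover have "\<bar>Sv - V\<bar> * norm c \<le> \<eta> * R"
        using 2(2)[OF p(1) fine(2)] R(2)[OF c(1)] \<eta> R(1)
        by (intro mult_mono) (auto simp: Sv_def)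
      ultimately show ?thesis using 4 by linarith
    qed
    also have "\<dots> \<le> E + \<theta>"
      using 3(2)[OF p(1) fine(3)] \<eta>_sum by (simp add: Se_def)
    finally show ?thesis using c0(2)[OF c(1)] by linarith
  qed
  then have "norm (H - V *\<^sub>R c0) \<le> E" by (rule field_le_epsilon)
  with c0(1) show ?thesis unfolding H_def V_def E_def by blast
qed

text \<open>Adjoining the negatives of \<open>G\<close> absorbs the sign of \<open>u\<close>;
  division by \<open>\<bar>u\<bar> + 1\<close> then leaves a convex combination. The hull is the
  same for all \<open>u\<close>, which later makes the nets independent of the control.\<close>

lemma combination_in_convex_hull_symmetric:
  fixes g1 g2 :: "'a::real_vector"
  assumes "g1 \<in> G" "g2 \<in> G"
  shows "\<exists>c \<in> convex hull (G \<union> uminus ` G). u *\<^sub>R g1 + g2 = (\<bar>u\<bar> + 1) *\<^sub>R c"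
proof -
  define v where "v = \<bar>u\<bar> + 1"
  have v: "v > 0" "\<bar>u\<bar> / v + 1 / v = 1" by (simp_all add: v_def add_divide_distrib[symmetric])
  define g where "g = (if u \<ge> 0 then g1 else - g1)"
  have "(\<bar>u\<bar> / v) *\<^sub>R g + (1 / v) *\<^sub>R g2 \<in> convex hull (G \<union> uminus ` G)"
    using v assms by (intro convexD convex_convex_hull hull_inc) (auto simp: g_def)
  moreover have "v *\<^sub>R ((\<bar>u\<bar> / v) *\<^sub>R g + (1 / v) *\<^sub>R g2) = u *\<^sub>R g1 + g2"
    using v by (auto simp: scaleR_add_right g_def)
  ultimately show ?thesis unfolding v_def by metis
qed

section \<open>Exponential weights of an integrated density\<close>

text \<open>Nonnegativity makes \<open>v\<close> absolutely integrable, and this survives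
  multiplication by the exponential, which is continuous and hence bounded on the compact
  interval.\<close>

lemma integrable_mult_exp_integral:
  fixes v :: "real \<Rightarrow> real"
  assumes v: "v integrable_on {0..T}" and v0: "\<And>s. s \<in> {0..T} \<Longrightarrow> 0 \<le> v s"
  shows "(\<lambda>s. v s * exp (\<mu> * integral {0..s} v)) integrable_on {0..T}"
proof -
  have c: "continuous_on {0..T} (\<lambda>s. exp (\<mu> * integral {0..s} v))"
    by (intro continuous_intros indefinite_integral_continuous_1 v)
  have "(\<lambda>s. exp (\<mu> * integral {0..s} v) * v s) absolutely_integrable_on {0..T}"
    by (intro absolutely_integrable_bounded_measurable_product_real
        continuous_imp_measurable_on_sets_lebesgue c nonnegative_absolutely_integrable_1 v v0
        compact_imp_bounded compact_continuous_image) auto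
  then show ?thesis
    by (simp add: absolutely_integrable_on_def mult.commute)
qed

text \<open>The sharp constant is \<open>1/\<mu>\<close>; the factor 2 lets us argue on short intervals, where the
  weight at most doubles, instead of invoking the chain rule for absolutely continuous functions.\<close>

lemma integral_mult_exp_integral_le:
  fixes v :: "real \<Rightarrow> real"
  assumes v: "v integrable_on {0..T}" and v0: "\<And>s. s \<in> {0..T} \<Longrightarrow> 0 \<le> v s"
    and \<mu>: "\<mu> > 0" and T: "T \<ge> 0"
  shows "integral {0..T} (\<lambda>s. v s * exp (\<mu> * integral {0..s} v)) \<le> 2 / \<mu> * exp (\<mu> * integral {0..T} v)"
proof -
  define U where "U = (\<lambda>t. integral {0..t} v)"
  define w where "w = (\<lambda>t. exp (\<mu> * U t))"
  define g where "g = (\<lambda>t. integral {0..t} (\<lambda>s. v s * w s))"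
  have vw: "(\<lambda>s. v s * w s) integrable_on {0..T}"
    unfolding w_def U_def by (rule integrable_mult_exp_integral[OF v v0])
  have sub: "f integrable_on {a..b}" if "f integrable_on {0..T}" "0 \<le> a" "b \<le> T"
    for a b and f :: "real \<Rightarrow> real"
    using integrable_subinterval_real[OF that(1)] that by auto
  have Uab: "U b = U a + integral {a..b} v" and gab: "g b = g a + integral {a..b} (\<lambda>s. v s * w s)"
    if "0 \<le> a" "a \<le> b" "b \<le> T" for a b
    unfolding U_def g_def
    using Henstock_Kurzweil_Integration.integral_combine[OF that(1,2) sub[OF v order_refl that(3)]]
      Henstock_Kurzweil_Integration.integral_combine[OF that(1,2) sub[OF vw order_refl that(3)]] by simp_all
  have Umono: "U a \<le> U b" if "0 \<le> a" "a \<le> b" "b \<le> T" for a b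
    using Uab[OF that] integral_nonneg[OF sub[OF v that(1,3)]] v0 that by auto
  have "uniformly_continuous_on {0..T} U"
    unfolding U_def by (intro compact_uniformly_continuous indefinite_integral_continuous_1 v) simp
  \<comment> \<open>An increment of \<open>U\<close> below \<open>ln 2 / \<mu>\<close> multiplies
    the weight \<open>w\<close> by at most 2.\<close>
  moreover have "ln 2 / \<mu> > 0" using \<mu> by simp
  ultimately obtain d where d: "d > 0"
    "\<And>x y. x \<in> {0..T} \<Longrightarrow> y \<in> {0..T} \<Longrightarrow> dist x y < d \<Longrightarrow> dist (U x) (U y) < ln 2 / \<mu>"
    unfolding uniformly_continuous_on_def by metis
  have step: "g b - g a \<le> 2 / \<mu> * (w b - w a)" if ab: "0 \<le> a" "a \<le> b" "b \<le> T" "b - a < d" for a b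
  proof -
    have "\<mu> * (U b - U a) \<le> ln 2"
      using d(2)[of a b] ab \<mu> Umono[of a b] by (auto simp: dist_real_def field_simps)
    then have "exp (\<mu> * (U b - U a)) \<le> 2"
      by (metis exp_le_cancel_iff exp_ln zero_less_numeral)
    then have wb: "w b \<le> 2 * w a"
      by (simp add: w_def right_diff_distrib exp_diff field_simps)
    \<comment> \<open>The increasing weight is replaced by its value at \<open>b\<close>, then by
      twice its value at \<open>a\<close>; the inequality \<open>x \<le> exp x - 1\<close> turns the
      result into an increment of \<open>w\<close>, which telescopes.\<close>
    have "g b - g a = integral {a..b} (\<lambda>s. v s * w s)" using gab[OF ab(1-3)] by simp
    also have "\<dots> \<le> integral {a..b} (\<lambda>s. v s * w b)"
      using ab \<mu> v0 Umono[OF _ _ ab(3)]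
      by (intro integral_le sub[OF vw] integrable_on_mult_left sub[OF v])
        (auto simp: w_def intro!: mult_left_mono)
    also have "\<dots> = (U b - U a) * w b" using Uab[OF ab(1-3)] by simp
    also have "\<dots> \<le> (U b - U a) * (2 * w a)"
      using Umono[OF ab(1-3)] wb by (intro mult_left_mono) auto
    also have "\<dots> = 2 / \<mu> * (w a * (\<mu> * (U b - U a)))" using \<mu> by simp
    also have "\<dots> \<le> 2 / \<mu> * (w a * (exp (\<mu> * (U b - U a)) - 1))"
    proof -
      have "\<mu> * (U b - U a) \<le> exp (\<mu> * (U b - U a)) - 1"
        using exp_ge_add_one_self[of "\<mu> * (U b - U a)"] by linarith
      then show ?thesis using \<mu> by (intro mult_left_mono) (simp_all add: w_def)
    qed
    also have "w a * (exp (\<mu> * (U b - U a)) - 1) = w b - w a"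
      by (simp add: w_def right_diff_distrib exp_diff)
    finally show ?thesis .
  qed
  \<comment> \<open>Increments are summed over steps of length at most \<open>d / 2\<close>, safely
    below \<open>d\<close>. For \<open>n = 0\<close> only \<open>b = 0\<close> remains, where
    \<open>g\<close> vanishes.\<close>
  have "\<forall>b. 0 \<le> b \<and> b \<le> T \<and> b \<le> real n * (d / 2) \<longrightarrow> g b \<le> 2 / \<mu> * w b" for n
  proof (induction n)
    case 0
    then show ?case using \<mu> by (auto simp: g_def w_def)
  next
    case (Suc n)
    show ?case
    proof clarify
      fix b assume b: "0 \<le> b" "b \<le> T" "b \<le> real (Suc n) * (d / 2)"
      define a where "a = max 0 (b - d / 2)"
      have "0 \<le> a" "a \<le> T" "a \<le> real n * (d / 2)"
        using b d(1) by (auto simp: a_def max_def algebra_simps)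
      then have "g a \<le> 2 / \<mu> * w a" using Suc.IH by blast
      moreover have "g b - g a \<le> 2 / \<mu> * (w b - w a)"
        using b d(1) by (intro step) (auto simp: a_def max_def)
      ultimately show "g b \<le> 2 / \<mu> * w b" by (simp add: right_diff_distrib)
    qed
  qed
  moreover obtain n where "T \<le> real n * (d / 2)"
    using reals_Archimedean3[of "d / 2"] d(1) by (metis half_gt_zero less_imp_le)
  ultimately show ?thesis using T unfolding g_def w_def U_def by blast
qed

section \<open>Halving the net error along mild solutions\<close>

text \<open>A Bielecki-type weight adapted to the control: \<open>\<bar>u s\<bar>\<close> accounts
  for the term with \<open>B\<close>, the summand 1 for the term with \<open>K\<close>.\<close>

definition control_weight :: "real \<Rightarrow> (real \<Rightarrow> real) \<Rightarrow> real \<Rightarrow> real" where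
  "control_weight \<mu> u t = exp (\<mu> * integral {0..t} (\<lambda>s. \<bar>u s\<bar> + 1))"

lemma control_weight_ge_1:
  assumes "\<mu> \<ge> 0" shows "1 \<le> control_weight \<mu> u t"
proof -
  have "integral {0..t} (\<lambda>s. \<bar>u s\<bar> + 1) \<ge> 0"
    \<comment> \<open>A non-integrable function has integral 0 by convention, so the bound holds for
      every \<open>u\<close>.\<close>
    by (cases "(\<lambda>s. \<bar>u s\<bar> + 1) integrable_on {0..t}")
      (auto intro: integral_nonneg simp: not_integrable_integral)
  with assms show ?thesis by (simp add: control_weight_def)
qed

text \<open>The net \<open>F'\<close> is uniform in the control: only the weight depends on \<open>u\<close>.\<close>

lemma mild_solution_net_step:
  fixes S :: "real \<Rightarrow> 'a::banach \<Rightarrow> 'a"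
  assumes S_lip: "\<And>r x y. r \<in> {0..N} \<Longrightarrow> norm (S r x - S r y) \<le> c * norm (x - y)"
    and S_cont: "\<And>x. continuous_on {0..N} (\<lambda>r. S r x)"
    and B: "\<beta>-lipschitz_on UNIV B" and K: "k-lipschitz_on UNIV K"
    and c0: "c \<ge> 0"
    and \<mu>: "\<mu> = 8 * (c * \<beta> + c * k + 1)"
    and F: "finite F" and \<epsilon>: "\<epsilon> > 0"
  obtains F' where "finite F'"
    "\<And>u psi T t. \<lbrakk>T \<le> N; (\<lambda>s. \<bar>u s\<bar>) integrable_on {0..T}; integral {0..T} (\<lambda>s. \<bar>u s\<bar>) \<le> N;
       mild_solution S B K u psi0 T psi;
       \<And>s. s \<in> {0..T} \<Longrightarrow> \<exists>p\<in>F. norm (psi s - p) \<le> \<epsilon> * control_weight \<mu> u s;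
       t \<in> {0..T}\<rbrakk> \<Longrightarrow> \<exists>p\<in>F'. norm (psi t - p) \<le> \<epsilon> / 2 * control_weight \<mu> u t"
proof -
  have nn: "\<beta> \<ge> 0" "k \<ge> 0" using B K lipschitz_on_nonneg by auto
  have \<mu>1: "\<mu> \<ge> 8" using nn c0 by (simp add: \<mu>)
  \<comment> \<open>The last estimate adds two errors \<open>\<delta> * w t\<close>, one from the
    integral and one from the net \<open>F'\<close>; together they give
    \<open>\<epsilon> / 2\<close>.\<close>
  define \<delta> where "\<delta> = \<epsilon> / 4"
  have \<delta>: "\<delta> > 0" using \<epsilon> by (simp add: \<delta>_def)
  \<comment> \<open>Orbits of the finitely many points \<open>B p\<close> and \<open>K p\<close>
    over a compact time interval: compact by strong continuity.\<close>
  define Q where "Q = (\<Union>p\<in>F. (\<lambda>r. S r (B p)) ` {0..N}) \<union> (\<Union>p\<in>F. (\<lambda>r. S r (K p)) ` {0..N})"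
  have Q: "S r (B p) \<in> Q" "S r (K p) \<in> Q" if "p \<in> F" "r \<in> {0..N}" for p r
    using that unfolding Q_def by blast+
  have "compact Q"
    unfolding Q_def
    by (intro compact_Un compact_UN F compact_continuous_image S_cont) auto
  then obtain G where G: "finite G" "\<And>x. x \<in> Q \<Longrightarrow> \<exists>g\<in>G. norm (x - g) \<le> \<delta>"
    using compact_finite_net[OF _ \<delta>] by metis
  define C where "C = convex hull (G \<union> uminus ` G)"
  have C: "compact C" "convex C"
    unfolding C_def using G(1) by (auto intro: finite_imp_compact_convex_hull)
  \<comment> \<open>This compact set holds the approximations of Duhamel's formula for all
    admissible controls at once; the scalar is the integral of \<open>\<bar>u\<bar> + 1\<close>, at
    most \<open>N + N\<close>.\<close>
  define P where "P = (\<lambda>(r, a, x). S r psi0 + a *\<^sub>R x) ` ({0..N} \<times> {0..2*N} \<times> C)"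
  have "compact P"
    unfolding P_def case_prod_beta
    by (intro compact_continuous_image compact_Times C continuous_intros
        continuous_on_compose2[OF S_cont[of psi0]]) auto
  then obtain F' where F': "finite F'" "\<And>x. x \<in> P \<Longrightarrow> \<exists>p\<in>F'. norm (x - p) \<le> \<delta>"
    using compact_finite_net[OF _ \<delta>] by metis
  show ?thesis
  proof
    show "finite F'" by (rule F')
  next
    fix u psi T t
    assume TN: "T \<le> N" and u: "(\<lambda>s. \<bar>u s\<bar>) integrable_on {0..T}"
      "integral {0..T} (\<lambda>s. \<bar>u s\<bar>) \<le> N"
      and psi: "mild_solution S B K u psi0 T psi"
      and near: "\<And>s. s \<in> {0..T} \<Longrightarrow> \<exists>p\<in>F. norm (psi s - p) \<le> \<epsilon> * control_weight \<mu> u s"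
      and t: "t \<in> {0..T}"
    define w where "w = control_weight \<mu> u"
    define v where "v = (\<lambda>s. \<bar>u s\<bar> + 1)"
    have w1: "1 \<le> w s" for s using \<mu>1 control_weight_ge_1 by (simp add: w_def)
    define f1 where "f1 = (\<lambda>s. S (t - s) (B (psi s)))"
    define f2 where "f2 = (\<lambda>s. S (t - s) (K (psi s)))"
    define h where "h = (\<lambda>s. u s *\<^sub>R f1 s + f2 s)"
    have f: "(\<lambda>s. u s *\<^sub>R f1 s) integrable_on {0..t}" "f2 integrable_on {0..t}"
      "psi t = S t psi0 + integral {0..t} (\<lambda>s. u s *\<^sub>R f1 s) + integral {0..t} f2"
      using psi t unfolding mild_solution_def f1_def f2_def by blast+
    have h: "h integrable_on {0..t}" "psi t = S t psi0 + integral {0..t} h"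
      unfolding h_def using f by (simp_all add: integrable_add integral_add)
    have ut: "(\<lambda>s. \<bar>u s\<bar>) integrable_on {0..t}"
      using integrable_subinterval_real[OF u(1)] t by auto
    have v: "v integrable_on {0..t}"
      unfolding v_def by (intro integrable_add ut) (rule integrable_const_ivl)
    have "integral {0..t} (\<lambda>s. \<bar>u s\<bar>) \<le> integral {0..T} (\<lambda>s. \<bar>u s\<bar>)"
      using t by (intro integral_subset_le ut u) auto
    moreover have "integral {0..t} v = integral {0..t} (\<lambda>s. \<bar>u s\<bar>) + t"
      unfolding v_def using t by (subst integral_add[OF ut integrable_const_ivl]) auto
    moreover have "integral {0..t} v \<ge> 0"
      by (rule integral_nonneg[OF v]) (simp add: v_def)
    ultimately have V: "integral {0..t} v \<in> {0..2*N}" using u(2) t TN by auto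
    define \<eta> where "\<eta> = (c * \<beta> + c * k) * \<epsilon> + \<delta>"
    \<comment> \<open>Stated for a generic map \<open>R\<close>, to be used with both
      \<open>B\<close> and \<open>K\<close>; bounding either Lipschitz constant by
      \<open>\<beta> + k\<close> lets one \<open>\<eta>\<close> serve both.\<close>
    have near_G: "\<exists>g\<in>G. norm (S (t - s) (R (psi s)) - g) \<le> \<eta> * w s"
      if s: "s \<in> {0..t}" and R: "\<And>x y. norm (R x - R y) \<le> l * norm (x - y)" "0 \<le> l" "l \<le> \<beta> + k"
        and RQ: "\<And>p r. p \<in> F \<Longrightarrow> r \<in> {0..N} \<Longrightarrow> S r (R p) \<in> Q" for s R l
    proof -
      obtain p where p: "p \<in> F" "norm (psi s - p) \<le> \<epsilon> * w s"
        using near[of s] s t by (auto simp: w_def)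
      have ts: "t - s \<in> {0..N}" using s t TN by auto
      obtain g where g: "g \<in> G" "norm (S (t - s) (R p) - g) \<le> \<delta>"
        using G(2)[OF RQ[OF p(1) ts]] by blast
      have "norm (S (t - s) (R (psi s)) - S (t - s) (R p)) \<le> c * norm (R (psi s) - R p)"
        by (rule S_lip[OF ts])
      also have "\<dots> \<le> c * (l * norm (psi s - p))"
        by (intro mult_left_mono R c0)
      also have "\<dots> \<le> c * ((\<beta> + k) * (\<epsilon> * w s))"
        using R nn p by (intro mult_left_mono mult_mono c0) auto
      finally have "norm (S (t - s) (R (psi s)) - g) \<le> c * ((\<beta> + k) * (\<epsilon> * w s)) + \<delta>"
        using g(2) norm_triangle_le[of "S (t - s) (R (psi s)) - S (t - s) (R p)" "S (t - s) (R p) - g"]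
        by simp
      also have "\<dots> \<le> c * ((\<beta> + k) * (\<epsilon> * w s)) + \<delta> * w s"
        using \<delta> w1 by simp
      also have "\<dots> = \<eta> * w s" by (simp add: \<eta>_def algebra_simps)
      finally show ?thesis using g(1) by blast
    qed
    have near_C: "\<exists>x\<in>C. norm (h s - v s *\<^sub>R x) \<le> \<eta> * (v s * w s)" if s: "s \<in> {0..t}" for s
    proof -
      have "\<exists>g\<in>G. norm (f1 s - g) \<le> \<eta> * w s"
        unfolding f1_def
        by (rule near_G[OF s, of B \<beta>]) (use B nn in \<open>auto simp: Q lipschitz_on_def dist_norm\<close>)
      then obtain g1 where g1: "g1 \<in> G" "norm (f1 s - g1) \<le> \<eta> * w s"
        by blast
      have "\<exists>g\<in>G. norm (f2 s - g) \<le> \<eta> * w s"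
        unfolding f2_def
        by (rule near_G[OF s, of K k]) (use K nn in \<open>auto simp: Q lipschitz_on_def dist_norm\<close>)
      then obtain g2 where g2: "g2 \<in> G" "norm (f2 s - g2) \<le> \<eta> * w s"
        by blast
      obtain x where x: "x \<in> C" "u s *\<^sub>R g1 + g2 = v s *\<^sub>R x"
        using combination_in_convex_hull_symmetric[OF g1(1) g2(1), of "u s"]
        unfolding C_def v_def by blast
      have "norm (h s - v s *\<^sub>R x) = norm (u s *\<^sub>R (f1 s - g1) + (f2 s - g2))"
        by (simp add: h_def x(2)[symmetric] algebra_simps)
      also have "\<dots> \<le> \<bar>u s\<bar> * norm (f1 s - g1) + norm (f2 s - g2)"
        by (metis norm_scaleR norm_triangle_ineq)
      also have "\<dots> \<le> \<bar>u s\<bar> * (\<eta> * w s) + \<eta> * w s"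
        by (intro add_mono mult_left_mono g1 g2) simp
      also have "\<dots> = \<eta> * (v s * w s)" by (simp add: v_def algebra_simps)
      finally show ?thesis using x(1) by blast
    qed
    \<comment> \<open>\<open>F\<close> is not assumed nonempty; the net hypothesis at time 0
      supplies a point.\<close>
    have "C \<noteq> {}" using near_C[of 0] t by auto
    have w_eq: "w = (\<lambda>s. exp (\<mu> * integral {0..s} v))"
      by (simp add: w_def v_def control_weight_def fun_eq_iff)
    have vw: "(\<lambda>s. v s * w s) integrable_on {0..t}"
      unfolding w_eq by (rule integrable_mult_exp_integral[OF v]) (simp add: v_def)
    have "\<exists>x\<in>C. norm (integral {0..t} h - integral {0..t} v *\<^sub>R x) \<le> integral {0..t} (\<lambda>s. \<eta> * (v s * w s))"
      using h(1) v vw C \<open>C \<noteq> {}\<close> near_C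
      by (intro integral_near_compact_convex[where a = 0 and b = t, unfolded cbox_interval]
          integrable_on_mult_right) (auto simp: v_def)
    then obtain x where x: "x \<in> C"
      "norm (integral {0..t} h - integral {0..t} v *\<^sub>R x) \<le> \<eta> * integral {0..t} (\<lambda>s. v s * w s)"
      by auto
    have "\<eta> * integral {0..t} (\<lambda>s. v s * w s) \<le> \<eta> * (2 / \<mu> * w t)"
      unfolding w_eq using t nn c0 \<epsilon> \<delta> \<mu>1
      by (intro mult_left_mono integral_mult_exp_integral_le[OF v]) (auto simp: v_def \<eta>_def)
    also have "\<dots> \<le> \<delta> * w t"
    proof -
      \<comment> \<open>By the choice of \<open>\<mu>\<close>, the right side is
        \<open>2 * \<epsilon> * (c * \<beta> + c * k + 1)\<close>, while the left side is
        \<open>2 * \<epsilon> * (c * \<beta> + c * k) + \<epsilon> / 2\<close>.\<close>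
      have "2 * \<eta> \<le> \<delta> * \<mu>"
        using \<epsilon> by (simp add: \<eta>_def \<delta>_def \<mu> field_simps)
      then have "\<eta> * (2 / \<mu>) \<le> \<delta>"
        using \<mu>1 by (simp add: field_simps)
      then have "\<eta> * (2 / \<mu>) * w t \<le> \<delta> * w t" using w1[of t] by (intro mult_right_mono) auto
      then show ?thesis by (simp only: mult.assoc)
    qed
    finally have 1: "norm (integral {0..t} h - integral {0..t} v *\<^sub>R x) \<le> \<delta> * w t"
      using x(2) by linarith
    have "S t psi0 + integral {0..t} v *\<^sub>R x \<in> P"
      unfolding P_def using t TN V x(1)
      by (intro image_eqI[of _ _ "(t, integral {0..t} v, x)"]) auto
    then obtain p where p: "p \<in> F'" "norm (S t psi0 + integral {0..t} v *\<^sub>R x - p) \<le> \<delta>"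
      using F'(2) by blast
    have "norm (psi t - p) \<le> norm (integral {0..t} h - integral {0..t} v *\<^sub>R x)
        + norm (S t psi0 + integral {0..t} v *\<^sub>R x - p)"
      unfolding h(2)
      using norm_triangle_ineq[of "integral {0..t} h - integral {0..t} v *\<^sub>R x"
          "S t psi0 + integral {0..t} v *\<^sub>R x - p"]
      by (simp add: algebra_simps)
    also have "\<dots> \<le> \<delta> * w t + \<delta> * w t"
      using 1 p(2) \<delta> mult_left_mono[OF w1[of t], of \<delta>] by linarith
    finally show "\<exists>p\<in>F'. norm (psi t - p) \<le> \<epsilon> / 2 * control_weight \<mu> u t"
      using p(1) by (auto simp: \<delta>_def w_def)
  qed
qed

section \<open>Continuity of orbits and compactness of bounded reachable sets\<close>

text \<open>Factoring out the smaller of the two times reduces two-sided continuity to right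
  continuity at 0, with the uniform bound controlling the factor.\<close>

lemma c0_semigroup_continuous_on:
  fixes S :: "real \<Rightarrow> 'a::banach \<Rightarrow> 'a"
  assumes S: "c0_semigroup S"
    and bound: "\<And>r x. r \<in> {0..N} \<Longrightarrow> norm (S r x) \<le> c * norm x"
  shows "continuous_on {0..N} (\<lambda>r. S r x)"
proof -
  have lin: "\<And>t. t \<ge> 0 \<Longrightarrow> bounded_linear (S t)"
    and add: "\<And>t s. t \<ge> 0 \<Longrightarrow> s \<ge> 0 \<Longrightarrow> S (t + s) = S t \<circ> S s"
    and lim: "((\<lambda>t. S t x) \<longlongrightarrow> x) (at_right 0)" and S0: "S 0 = id"
    using S unfolding c0_semigroup_def by blast+
  have *: "norm (S b x - S a x) \<le> c * norm (S (b - a) x - x)" if "0 \<le> a" "a \<le> b" "b \<le> N" for a b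
  proof -
    have "S b x = S a (S (b - a) x)" using add[of a "b - a"] that by (simp add: fun_eq_iff)
    then have "S b x - S a x = S a (S (b - a) x - x)"
      using lin[of a] that by (simp add: linear_diff bounded_linear.linear)
    then show ?thesis using bound[of a] that by simp
  qed
  have **: "dist (S b x) (S a x) \<le> c * norm (S \<bar>b - a\<bar> x - x)" if "a \<in> {0..N}" "b \<in> {0..N}" for a b
    using *[of a b] *[of b a] that
    by (cases "a \<le> b") (auto simp: dist_norm norm_minus_commute abs_real_def)
  show ?thesis
    unfolding continuous_on_iff
  proof (intro ballI allI impI)
    fix a e :: real assume a: "a \<in> {0..N}" and e: "e > 0"
    \<comment> \<open>The sign of \<open>c\<close> is not known here, so
      \<open>\<bar>c\<bar> + 1\<close> provides a positive denominator.\<close>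
    define e' where "e' = e / (\<bar>c\<bar> + 1)"
    have e': "e' > 0" using e by (simp add: e'_def)
    obtain d where d: "d > 0" "\<And>h. 0 < h \<Longrightarrow> h < d \<Longrightarrow> dist (S h x) x < e'"
      using tendstoD[OF lim e'] unfolding eventually_at_right_field by auto
    have d': "norm (S h x - x) < e'" if "0 \<le> h" "h < d" for h
      using d(2)[of h] that e' S0 by (cases "h = 0") (auto simp: dist_norm)
    have "dist (S b x) (S a x) < e" if b: "b \<in> {0..N}" "dist b a < d" for b
    proof -
      have "dist (S b x) (S a x) \<le> c * norm (S \<bar>b - a\<bar> x - x)" by (rule **[OF a b(1)])
      also have "\<dots> \<le> (\<bar>c\<bar> + 1) * norm (S \<bar>b - a\<bar> x - x)" by (intro mult_right_mono) auto
      also have "\<dots> < (\<bar>c\<bar> + 1) * e'"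
        using d'[of "\<bar>b - a\<bar>"] b(2) by (intro mult_strict_left_mono) (auto simp: dist_real_def)
      also have "\<dots> = e" by (simp add: e'_def)
      finally show ?thesis .
    qed
    then show "\<exists>d>0. \<forall>b\<in>{0..N}. dist b a < d \<longrightarrow> dist (S b x) (S a x) < e"
      using d(1) by blast
  qed
qed

lemma compact_closure_if_nets:
  fixes X :: "'a::{complete_space,real_normed_vector} set"
  assumes "\<And>e. e > 0 \<Longrightarrow> \<exists>F. finite F \<and> (\<forall>x\<in>X. \<exists>p\<in>F. norm (x - p) \<le> e)"
  shows "compact (closure X)"
  unfolding compact_eq_totally_bounded
proof (intro conjI allI impI)
  show "complete (closure X)" by (simp add: complete_eq_closed)
next
  fix e :: real assume e: "e > 0"
  obtain F where F: "finite F" "\<forall>x\<in>X. \<exists>p\<in>F. norm (x - p) \<le> e / 2"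
    using assms[of "e / 2"] e by auto
  \<comment> \<open>Closed balls of half the radius make the finite cover closed, so that it
    contains the closure as well.\<close>
  have "X \<subseteq> (\<Union>p\<in>F. cball p (e / 2))"
    using F(2) by (fastforce simp: dist_norm norm_minus_commute)
  then have "closure X \<subseteq> (\<Union>p\<in>F. cball p (e / 2))"
    by (intro closure_minimal closed_UN F(1)) auto
  also have "\<dots> \<subseteq> (\<Union>p\<in>F. ball p e)"
    using e by (intro UN_mono) (auto simp: dist_norm)
  finally show "\<exists>F. finite F \<and> closure X \<subseteq> (\<Union>p\<in>F. ball p e)"
    using F(1) by blast
qed

text \<open>Bounding the trajectory as well as the control spares a Gronwall estimate: it makes
  \<open>{0}\<close> a net at distance \<open>N\<close> to start the iteration.\<close>

definition bounded_reachable ::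
  "(real \<Rightarrow> 'a::banach \<Rightarrow> 'a) \<Rightarrow> ('a \<Rightarrow> 'a) \<Rightarrow> ('a \<Rightarrow> 'a) \<Rightarrow> 'a \<Rightarrow> real \<Rightarrow> 'a set" where
  "bounded_reachable S B K psi0 N = {psi t | t u psi. 0 \<le> t \<and> t \<le> N \<and>
     (\<lambda>s. \<bar>u s\<bar>) integrable_on {0..t} \<and> integral {0..t} (\<lambda>s. \<bar>u s\<bar>) \<le> N \<and>
     mild_solution S B K u psi0 t psi \<and> (\<forall>s\<in>{0..t}. norm (psi s) \<le> N)}"

lemma compact_closure_bounded_reachable:
  fixes S :: "real \<Rightarrow> 'a::banach \<Rightarrow> 'a"
  assumes S_lip: "\<And>r x y. r \<in> {0..N} \<Longrightarrow> norm (S r x - S r y) \<le> c * norm (x - y)"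
    and S_cont: "\<And>x. continuous_on {0..N} (\<lambda>r. S r x)"
    and B: "\<beta>-lipschitz_on UNIV B" and K: "k-lipschitz_on UNIV K"
    and c0: "c \<ge> 0" and N: "N > 0"
  shows "compact (closure (bounded_reachable S B K psi0 N))"
proof -
  define \<mu> where "\<mu> = 8 * (c * \<beta> + c * k + 1)"
  have \<mu>0: "\<mu> \<ge> 0"
    using B K c0 lipschitz_on_nonneg[OF B] lipschitz_on_nonneg[OF K] by (simp add: \<mu>_def)
  \<comment> \<open>The net must serve all times of each trajectory, since the halving step
    integrates over the past. The weight stays fixed during the iteration; only the net and the
    factor \<open>N / 2 ^ n\<close> change.\<close>
  have nets: "\<exists>F. finite F \<and> (\<forall>T u psi. T \<le> N \<longrightarrow> (\<lambda>s. \<bar>u s\<bar>) integrable_on {0..T} \<longrightarrow>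
      integral {0..T} (\<lambda>s. \<bar>u s\<bar>) \<le> N \<longrightarrow> mild_solution S B K u psi0 T psi \<longrightarrow>
      (\<forall>s\<in>{0..T}. norm (psi s) \<le> N) \<longrightarrow>
      (\<forall>s\<in>{0..T}. \<exists>p\<in>F. norm (psi s - p) \<le> N / 2 ^ n * control_weight \<mu> u s))" for n
  proof (induction n)
    case 0
    have "x \<le> N * control_weight \<mu> u s" if "x \<le> N" for x u s
      using that mult_left_mono[OF control_weight_ge_1[OF \<mu>0, of u s], of N] N by linarith
    then show ?case by (intro exI[of _ "{0}"]) auto
  next
    case (Suc n)
    then obtain F where F: "finite F" "\<And>T u psi s. \<lbrakk>T \<le> N; (\<lambda>s. \<bar>u s\<bar>) integrable_on {0..T};
      integral {0..T} (\<lambda>s. \<bar>u s\<bar>) \<le> N; mild_solution S B K u psi0 T psi;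
      \<forall>s\<in>{0..T}. norm (psi s) \<le> N; s \<in> {0..T}\<rbrakk> \<Longrightarrow>
      \<exists>p\<in>F. norm (psi s - p) \<le> N / 2 ^ n * control_weight \<mu> u s"
      by blast
    have "N / 2 ^ n > 0" using N by simp
    from mild_solution_net_step[OF S_lip S_cont B K c0 \<mu>_def F(1) this, of psi0]
    obtain F' where F': "finite F'"
      "\<And>u psi T t. \<lbrakk>T \<le> N; (\<lambda>s. \<bar>u s\<bar>) integrable_on {0..T}; integral {0..T} (\<lambda>s. \<bar>u s\<bar>) \<le> N;
       mild_solution S B K u psi0 T psi;
       \<And>s. s \<in> {0..T} \<Longrightarrow> \<exists>p\<in>F. norm (psi s - p) \<le> N / 2 ^ n * control_weight \<mu> u s;
       t \<in> {0..T}\<rbrakk> \<Longrightarrow> \<exists>p\<in>F'. norm (psi t - p) \<le> N / 2 ^ n / 2 * control_weight \<mu> u t"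
      by blast
    show ?case
    proof (intro exI[of _ F'] conjI allI impI ballI)
      fix T u psi s
      assume "T \<le> N" "(\<lambda>s. \<bar>u s\<bar>) integrable_on {0..T}"
        "integral {0..T} (\<lambda>s. \<bar>u s\<bar>) \<le> N" "mild_solution S B K u psi0 T psi"
        "\<forall>s\<in>{0..T}. norm (psi s) \<le> N" "s \<in> {0..T}"
      then have "\<exists>p\<in>F'. norm (psi s - p) \<le> N / 2 ^ n / 2 * control_weight \<mu> u s"
        by (intro F'(2) F(2))
      then show "\<exists>p\<in>F'. norm (psi s - p) \<le> N / 2 ^ Suc n * control_weight \<mu> u s"
        by (simp add: mult.commute)
    qed (rule F'(1))
  qed
  \<comment> \<open>Uniform bound for the weight: the integral of \<open>\<bar>u\<bar> + 1\<close>
    is at most \<open>N + N\<close>. It turns the weighted errors into the plain radius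
    \<open>e\<close> once \<open>2 ^ n\<close> exceeds \<open>N * W / e\<close>.\<close>
  define W where "W = exp (\<mu> * (2 * N))"
  have "\<exists>F. finite F \<and> (\<forall>x\<in>bounded_reachable S B K psi0 N. \<exists>p\<in>F. norm (x - p) \<le> e)"
    if e: "e > 0" for e
  proof -
    obtain n where n: "N * W / e < 2 ^ n" using real_arch_pow[of 2 "N * W / e"] by auto
    then have nW: "N / 2 ^ n * W \<le> e" using e by (simp add: field_simps)
    obtain F where F: "finite F" "\<And>T u psi s. \<lbrakk>T \<le> N; (\<lambda>s. \<bar>u s\<bar>) integrable_on {0..T};
      integral {0..T} (\<lambda>s. \<bar>u s\<bar>) \<le> N; mild_solution S B K u psi0 T psi;
      \<forall>s\<in>{0..T}. norm (psi s) \<le> N; s \<in> {0..T}\<rbrakk> \<Longrightarrow>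
      \<exists>p\<in>F. norm (psi s - p) \<le> N / 2 ^ n * control_weight \<mu> u s"
      using nets[of n] by blast
    have "\<forall>x\<in>bounded_reachable S B K psi0 N. \<exists>p\<in>F. norm (x - p) \<le> e"
      unfolding bounded_reachable_def
    proof clarify
      fix t u psi
      assume tN: "0 \<le> t" "t \<le> N"
        and u: "(\<lambda>s. \<bar>u s\<bar>) integrable_on {0..t}" "integral {0..t} (\<lambda>s. \<bar>u s\<bar>) \<le> N"
        and psi: "mild_solution S B K u psi0 t psi" "\<forall>s\<in>{0..t}. norm (psi s) \<le> N"
      obtain p where p: "p \<in> F" "norm (psi t - p) \<le> N / 2 ^ n * control_weight \<mu> u t"
        using F(2)[OF tN(2) u psi, of t] tN(1) by auto
      have "integral {0..t} (\<lambda>s. \<bar>u s\<bar> + 1) = integral {0..t} (\<lambda>s. \<bar>u s\<bar>) + t"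
        using tN by (subst integral_add[OF u(1) integrable_const_ivl]) auto
      then have "control_weight \<mu> u t \<le> W"
        using u(2) tN(2) \<mu>0 by (auto simp: control_weight_def W_def intro!: mult_left_mono)
      then have "N / 2 ^ n * control_weight \<mu> u t \<le> N / 2 ^ n * W"
        using N by (intro mult_left_mono) auto
      with p nW show "\<exists>p\<in>F. norm (psi t - p) \<le> e" by (meson order_trans)
    qed
    with F(1) show ?thesis by blast
  qed
  then show ?thesis by (rule compact_closure_if_nets)
qed

section \<open>Exhaustion of the attainable set by countably many compact sets\<close>

theorem theorem1p1:
  fixes S :: "real \<Rightarrow> 'a::banach \<Rightarrow> 'a"
    and A :: "'a \<Rightarrow> 'a" and D :: "'a set"
    and B K :: "'a \<Rightarrow> 'a"
    and \<omega> M k :: real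
    and psi0 :: 'a
  assumes "c0_semigroup S"
    and "generator S A D"
    and "\<omega> \<ge> 0" and "M > 0"
    and "\<forall>t\<ge>0. onorm (S t) \<le> M * exp (\<omega> * t)"
    and "bounded_linear B"
    and "k > 0" and "k-lipschitz_on UNIV K"
  shows "\<exists>C :: nat \<Rightarrow> 'a set. (\<forall>n. compact (C n)) \<and>
           attainable_set S B K psi0 \<subseteq> (\<Union>n. C n)"
proof (intro exI conjI allI)
  \<comment> \<open>\<open>Suc n\<close> keeps the bound positive, as the compactness lemma
    requires.\<close>
  let ?R = "\<lambda>n. bounded_reachable S B K psi0 (real (Suc n))"
  show "compact (closure (?R n))" for n
  proof -
    define N where "N = real (Suc n)"
    define c where "c = M * exp (\<omega> * N)"
    have lin: "bounded_linear (S r)" if "r \<ge> 0" for r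
      using assms(1) that unfolding c0_semigroup_def by blast
    have bound: "norm (S r x) \<le> c * norm x" if "r \<in> {0..N}" for r x
    proof -
      have "norm (S r x) \<le> onorm (S r) * norm x" using that by (intro onorm lin) simp
      also have "onorm (S r) \<le> M * exp (\<omega> * r)" using assms(5) that by simp
      also have "\<dots> \<le> c"
        unfolding c_def using assms(3,4) that by (intro mult_left_mono) (auto intro: mult_left_mono)
      finally show ?thesis by (simp add: mult_right_mono)
    qed
    have diff: "norm (S r x - S r y) \<le> c * norm (x - y)" if "r \<in> {0..N}" for r x y
      using bound[OF that, of "x - y"] lin[of r] that
      by (simp add: linear_diff bounded_linear.linear)
    have "norm (B x - B y) \<le> onorm B * norm (x - y)" for x y
      using onorm[OF assms(6), of "x - y"] linear_diff[OF bounded_linear.linear[OF assms(6)]]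
      by simp
    then have "(onorm B)-lipschitz_on UNIV B"
      by (intro lipschitz_onI) (simp_all add: dist_norm onorm_pos_le assms(6))
    then have "compact (closure (bounded_reachable S B K psi0 N))"
      using assms(4)
      by (intro compact_closure_bounded_reachable[OF diff
            c0_semigroup_continuous_on[OF assms(1) bound] _ assms(8)]) (auto simp: N_def c_def)
    then show ?thesis by (simp only: N_def)
  qed
  show "attainable_set S B K psi0 \<subseteq> (\<Union>n. closure (?R n))"
    unfolding attainable_set_def
  proof clarify
    fix t u psi
    assume t: "t \<ge> 0" and u: "u absolutely_integrable_on {0..t}"
      and psi: "mild_solution S B K u psi0 t psi"
    have u': "(\<lambda>s. \<bar>u s\<bar>) integrable_on {0..t}"
      using u by (simp add: absolutely_integrable_on_def)
    have "bounded (psi ` {0..t})"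
      using psi by (intro compact_imp_bounded compact_continuous_image) (auto simp: mild_solution_def)
    then obtain b where b: "\<And>s. s \<in> {0..t} \<Longrightarrow> norm (psi s) \<le> b"
      unfolding bounded_iff by blast
    \<comment> \<open>One natural number dominates the final time, the mass of the control and the
      norm of the trajectory, which is bounded by continuity on a compact interval.\<close>
    obtain n where n: "max t (max (integral {0..t} (\<lambda>s. \<bar>u s\<bar>)) b) \<le> real n"
      using real_arch_simple by blast
    have "\<forall>s\<in>{0..t}. norm (psi s) \<le> real (Suc n)"
      using b n by fastforce
    then have "psi t \<in> ?R n"
      unfolding bounded_reachable_def mem_Collect_eq using t u' psi n
      by (intro exI[of _ t] exI[of _ u] exI[of _ psi]) auto
    then show "psi t \<in> (\<Union>n. closure (?R n))"
      using closure_subset by blast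
  qed
qed

end
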